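(* Fix $\alpha>0$. For each $N\ge 2$, let $T_1,\ldots,T_N$ be drawn independently and uniformly at random from $\{n\in\mathbb{N}: n\le e^{\alpha N}\}$, and let $\Lambda_{j,k}$ denote the largest prime dividing both $T_j$ and $T_k$ (with $\Lambda_{j,k}:=1$ if $\gcd(T_j,T_k)=1$). Then for every $\theta>0$, \[ \limsup_{N\to\infty}\mathbb{P}\Big[\max_{1\le k<j\le N}\Lambda_{j,k}<\frac{N^2}{\log(N^{\theta})}\Big]\le e^{-\theta/8}. \] *)

theory Defs
  imports "HOL-Probability.Probability" "HOL-Computational_Algebra.Primes"
begin

definition Lambda :: "nat \<Rightarrow> nat \<Rightarrow> nat" where
  "Lambda a b = (if gcd a b = 1 then 1 else Max {p. prime p \<and> p dvd a \<and> p dvd b})"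

text \<open>Sample space: tuples (T_0,...,T_{N-1}) with entries in {1..floor(exp(alpha N))};
  the uniform distribution on it is the law of N independent uniform draws.\<close>
definition sample_space :: "real \<Rightarrow> nat \<Rightarrow> (nat \<Rightarrow> nat) set" where
  "sample_space \<alpha> N = PiE {..<N} (\<lambda>_. {1..nat \<lfloor>exp (\<alpha> * real N)\<rfloor>})"

definition prob_event :: "real \<Rightarrow> real \<Rightarrow> nat \<Rightarrow> real" where
  "prob_event \<alpha> \<theta> N =
     measure_pmf.prob (pmf_of_set (sample_space \<alpha> N))
       {T. real (Max {Lambda (T j) (T k) | j k. k < j \<and> j < N})
             < real N ^ 2 / ln (real N powr \<theta>)}"

end

theory Submission
  imports Defs "HOL-Number_Theory.Prime_Powers" "HOL-Real_Asymp.Real_Asymp"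
begin

text \<open>
  Let \<open>y = N\<^sup>2 / (\<theta> ln N)\<close> and let \<open>P\<close> be the set of primes in \<open>(y, 10 y]\<close>. Expose the numbers one after
  the other. As long as no prime of \<open>P\<close> has occurred twice, the set \<open>S\<close> of primes of \<open>P\<close> that have
  occurred satisfies \<open>\<Sum>\<^bsub>p\<in>S\<^esub> 1/p = \<Sum>\<^bsub>k\<^esub> w(T\<^sub>k)\<close> with \<open>w(t) = \<Sum>\<^bsub>p\<in>P, p dvd t\<^esub> 1/p\<close>, and by Bonferroni the next
  number avoids \<open>S\<close> with probability at most about \<open>exp (- \<Sum>\<^bsub>p\<in>S\<^esub> 1/p)\<close>. Hence the probability of
  no collision is essentially at most \<open>\<Prod>\<^bsub>k\<^esub> E exp (- (N - k) w(T\<^sub>k))\<close>, which is about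
  \<open>exp (- N\<^sup>2/2 \<Sum>\<^bsub>p\<in>P\<^esub> 1/p\<^sup>2)\<close>. The prime number theorem over all \<open>p > y\<close> would give the exponent
  \<open>- \<theta>/4\<close>; Chebyshev's bounds \<open>0.9 n \<le> \<Sum>\<^bsub>p \<le> n\<^esub> ln p \<le> 1.13 n\<close>, obtained from the factorial ratio
  \<open>n! (n/30)! / ((n/2)! (n/3)! (n/5)!)\<close>, lose less than a factor 2 and give \<open>- \<theta>/8\<close>.
\<close>

section \<open>Chebyshev's bounds\<close>

definition chebyshev_psi :: "nat \<Rightarrow> real" where
  "chebyshev_psi n = (\<Sum>d=1..n. mangoldt d)"

definition chebyshev_theta :: "nat \<Rightarrow> real" where
  "chebyshev_theta n = (\<Sum>p | prime p \<and> p \<le> n. ln (real p))"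

text \<open>Induction on \<open>n\<close>: \<open>ln (Suc n)\<close> is the sum of
  \<open>mangoldt d\<close> over the divisors of \<open>Suc n\<close>, and these are exactly the
  \<open>d\<close> for which \<open>n div d\<close> goes up by one. The free upper limit
  \<open>m\<close> lets several factorials be expanded over one common range.\<close>

lemma ln_fact_eq_sum_mangoldt:
  assumes "n \<le> m"
  shows "ln (fact n :: real) = (\<Sum>d=1..m. mangoldt d * real (n div d))"
  using assms
proof (induction n)
  case (Suc n)
  have "ln (fact (Suc n) :: real) = ln (Suc n) + ln (fact n :: real)"
    by (simp add: ln_mult)
  also have "ln (real (Suc n)) = (\<Sum>d | d dvd Suc n. mangoldt d)"
    using mangoldt_sum[of "Suc n", where 'a = real] by simp
  also have "\<dots> = (\<Sum>d=1..m. if d dvd Suc n then mangoldt d else 0)"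
  proof (rule sum.mono_neutral_cong_left)
    show "{d. d dvd Suc n} \<subseteq> {1..m}"
    proof
      fix d assume "d \<in> {d. d dvd Suc n}"
      then show "d \<in> {1..m}" using dvd_imp_le[of d "Suc n"] Suc.prems by (cases d) auto
    qed
  qed auto
  also have "\<dots> + ln (fact n :: real) = (\<Sum>d=1..m. mangoldt d * real (Suc n div d))"
    using Suc by (auto simp: sum.distrib[symmetric] div_Suc dvd_eq_mod_eq_0 algebra_simps intro!: sum.cong)
  finally show ?case .
qed simp

text \<open>\<open>ratio_exponent (n div d)\<close> is the multiplicity of \<open>mangoldt d\<close> in the logarithm of Chebyshev's
  factorial ratio.\<close>

definition ratio_exponent :: "nat \<Rightarrow> real" where
  "ratio_exponent m = real m - real (m div 2) - real (m div 3) - real (m div 5) + real (m div 30)"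

text \<open>Because 30 - 15 - 10 - 6 + 1 = 0, the function has period 30, so the first claim reduces
  to a check of 30 residues.\<close>

lemma ratio_exponent_range: "ratio_exponent m \<in> {0, 1}" "m \<in> {1..5} \<Longrightarrow> ratio_exponent m = 1"
proof -
  define q r where "q = m div 30" and "r = m mod 30"
  have m: "m = 30 * q + r" and r: "r < 30" by (auto simp: q_def r_def)
  have *: "m div 2 = 15 * q + r div 2" "m div 3 = 10 * q + r div 3" "m div 5 = 6 * q + r div 5"
       "m div 30 = q"
    using div_mult_self4[of 2 "15 * q" r] div_mult_self4[of 3 "10 * q" r] div_mult_self4[of 5 "6 * q" r]
    by (simp_all add: m r)
  have "r \<in> set [0..<30]" using r by auto
  then show "ratio_exponent m \<in> {0, 1}"
    unfolding ratio_exponent_def * unfolding m by (auto simp: upt_rec)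
  show "m \<in> {1..5} \<Longrightarrow> ratio_exponent m = 1"
  proof -
    assume "m \<in> {1..5}"
    then have "m \<in> set [1..<6]" by auto
    then show ?thesis by (auto simp: ratio_exponent_def upt_rec)
  qed
qed

definition ln_factorial_ratio :: "nat \<Rightarrow> real" where
  "ln_factorial_ratio n = ln (fact n) - ln (fact (n div 2)) - ln (fact (n div 3)) - ln (fact (n div 5)) + ln (fact (n div 30))"

lemma factorial_ratio_eq: "ln_factorial_ratio n = (\<Sum>d=1..n. mangoldt d * ratio_exponent (n div d))"
proof -
  have *: "ln (fact (n div k) :: real) = (\<Sum>d=1..n. mangoldt d * real (n div d div k))" for k
    by (subst ln_fact_eq_sum_mangoldt[of _ n]) (auto simp: div_mult2_eq[symmetric] mult.commute)
  show ?thesis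
    unfolding ln_factorial_ratio_def * ln_fact_eq_sum_mangoldt[OF order.refl, of n]
    by (simp add: sum_subtractf[symmetric] sum.distrib[symmetric] ratio_exponent_def algebra_simps)
qed

lemma factorial_ratio_le_chebyshev_psi: "ln_factorial_ratio n \<le> chebyshev_psi n"
  unfolding factorial_ratio_eq chebyshev_psi_def
proof (rule sum_mono)
  fix d
  show "mangoldt d * ratio_exponent (n div d) \<le> mangoldt d"
    using ratio_exponent_range(1)[of "n div d"] mangoldt_nonneg[of d] by auto
qed

text \<open>For \<open>n div 6 < d\<close> and \<open>d \<le> n\<close> the quotient
  \<open>n div d\<close> lies between 1 and 5, where the exponent is exactly 1; all smaller
  \<open>d\<close> contribute nonnegative terms.\<close>

lemma chebyshev_psi_diff_le_factorial_ratio: "chebyshev_psi n - chebyshev_psi (n div 6) \<le> ln_factorial_ratio n"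
proof -
  have "chebyshev_psi n = chebyshev_psi (n div 6) + (\<Sum>d=n div 6 + 1..n. mangoldt d)"
    unfolding chebyshev_psi_def using sum.ub_add_nat[of 1 "n div 6" mangoldt "n - n div 6"] by simp
  moreover have "(\<Sum>d=n div 6 + 1..n. mangoldt d) \<le> ln_factorial_ratio n"
    unfolding factorial_ratio_eq
  proof -
    have "(\<Sum>d=n div 6 + 1..n. mangoldt d) = (\<Sum>d=n div 6 + 1..n. mangoldt d * ratio_exponent (n div d))"
    proof (rule sum.cong)
      fix d assume d: "d \<in> {n div 6 + 1..n}"
      then have "n < 6 * d" by auto
      then have "n div d < 6" by (simp add: less_mult_imp_div_less)
      moreover have "1 \<le> n div d" using d by (auto simp: Suc_le_eq div_greater_zero_iff)
      ultimately show "mangoldt d = mangoldt d * ratio_exponent (n div d)"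
        by (subst ratio_exponent_range(2)) auto
    qed auto
    also have "\<dots> \<le> (\<Sum>d=1..n. mangoldt d * ratio_exponent (n div d))"
    proof (rule sum_mono2)
      fix d
      show "0 \<le> mangoldt d * ratio_exponent (n div d)"
        using ratio_exponent_range(1)[of "n div d"] mangoldt_nonneg[of d] by auto
    qed auto
    finally show "(\<Sum>d=n div 6 + 1..n. mangoldt d) \<le> (\<Sum>d=1..n. mangoldt d * ratio_exponent (n div d))" .
  qed
  ultimately show ?thesis by simp
qed

section \<open>Stirling-type estimates and the limit of the factorial ratio\<close>

text \<open>Both inductions compare \<open>ln (Suc n)\<close> with the increment of the bound; this
  comes down to 1/(n+1) <= ln(1 + 1/n) <= 1/n.\<close>

lemma ln_fact_bounds:
  assumes "n \<ge> 1"
  shows "real n * ln n - n \<le> ln (fact n)" "ln (fact n) \<le> real n * ln n - n + ln n + 1"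
  using assms
proof (induction n rule: dec_induct)
  case (step n)
  have n: "real n > 0" using step.hyps by simp
  have fs: "ln (fact (Suc n) :: real) = ln (Suc n) + ln (fact n :: real)"
    by (simp add: ln_mult)
  have le1: "ln (1 + 1 / real n) \<le> 1 / n" using n by (intro ln_add_one_self_le_self) auto
  have ge1: "ln (1 + 1 / real n) \<ge> 1 / (n + 1)"
  proof -
    have "ln (real n / (n + 1)) \<le> real n / (n + 1) - 1" using n by (intro ln_le_minus_one) auto
    then show ?thesis using n by (simp add: ln_div field_simps)
  qed
  have eq: "ln (real (Suc n)) = ln n + ln (1 + 1 / real n)"
  proof -
    have "1 + 1 / real n > 0" using n by (simp add: add_pos_pos)
    then show ?thesis using n ln_mult[of "real n" "1 + 1 / real n"] by (simp add: distrib_left add.commute)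
  qed
  have *: "real n * ln (1 + 1 / real n) \<le> 1" "1 \<le> real (n + 1) * ln (1 + 1 / real n)"
    using le1 ge1 n by (auto simp: field_simps)
  { case 1 then show ?case unfolding fs using step.IH(1) * eq by (simp add: algebra_simps)
  next case 2 then show ?case unfolding fs using step.IH(2) * eq by (simp add: algebra_simps) }
qed auto

text \<open>The derivative \<open>ln x\<close> is nonnegative from 1 on. This transfers the
  factorial bounds at the integer \<open>n div k\<close> to the real points n/k - 1 and n/k
  enclosing it.\<close>

lemma mono_x_ln_x:
  assumes "1 \<le> x" "x \<le> (y::real)" shows "x * ln x - x \<le> y * ln y - y"
proof -
  have "ln (y / x) \<ge> 0" using assms by (intro ln_ge_zero) auto
  have "ln (x / y) \<le> x / y - 1" using assms by (intro ln_le_minus_one) auto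
  then have "y * (ln x - ln y) \<le> x - y" using assms by (simp add: ln_div field_simps)
  moreover have "0 \<le> (y - x) * ln x" using assms by auto
  ultimately show ?thesis by (simp add: algebra_simps)
qed

lemma ln_fact_div_limit:
  assumes "k > 0"
  shows "(\<lambda>n. ln (fact (n div k)) / n - ln n / k) \<longlonglongrightarrow> - (1 + ln k) / k"
proof (rule tendsto_sandwich)
  let ?x = "\<lambda>n. real n / real k"
  show "(\<lambda>n. ((?x n - 1) * ln (?x n - 1) - (?x n - 1)) / n - ln n / k) \<longlonglongrightarrow> - (1 + ln k) / k"
    using assms by (real_asymp simp: ln_div field_simps)
  show "(\<lambda>n. (?x n * ln (?x n) - ?x n + ln (?x n) + 1) / n - ln n / k) \<longlonglongrightarrow> - (1 + ln k) / k"
    using assms by (real_asymp simp: ln_div field_simps)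
  \<comment> \<open>This puts n/k - 1 into the range from 1 on where \<open>mono_x_ln_x\<close>
    applies.\<close>
  have ev: "eventually (\<lambda>n. n \<ge> 2 * k) sequentially" by (rule eventually_ge_at_top)
  have bnd: "1 \<le> ?x n - 1 \<and> ?x n - 1 \<le> real (n div k) \<and> real (n div k) \<le> ?x n \<and> n > 0" 
    if "n \<ge> 2 * k" for n
  proof -
    have "real (n div k) \<le> ?x n" using of_nat_div_le_of_nat[of n k, where 'a = real] by simp
    moreover have "?x n - 1 \<le> real (n div k)"
    proof -
      have "n < k + k * (n div k)" using assms by (intro dividend_less_times_div)
      then have "real n < real k + real k * real (n div k)"
        by (metis of_nat_add of_nat_less_iff of_nat_mult)
      then show ?thesis using assms by (simp add: pos_divide_le_eq algebra_simps)
    qed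
    moreover have "2 * real k \<le> real n" using that by linarith
    then have "1 \<le> ?x n - 1" using assms by (simp add: pos_le_divide_eq)
    ultimately show ?thesis using that assms by simp
  qed
  show "\<forall>\<^sub>F n in sequentially. ((?x n - 1) * ln (?x n - 1) - (?x n - 1)) / n - ln n / k \<le> ln (fact (n div k)) / n - ln n / k"
    using ev
  proof eventually_elim
    case (elim n)
    note b = bnd[OF elim]
    have "(?x n - 1) * ln (?x n - 1) - (?x n - 1) \<le> real (n div k) * ln (n div k) - (n div k)"
      using b by (intro mono_x_ln_x) auto
    also have "\<dots> \<le> ln (fact (n div k))" using b by (intro ln_fact_bounds) linarith
    finally show ?case by (intro diff_right_mono divide_right_mono) auto
  qed
  show "\<forall>\<^sub>F n in sequentially. ln (fact (n div k)) / n - ln n / k \<le> (?x n * ln (?x n) - ?x n + ln (?x n) + 1) / n - ln n / k"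
    using ev
  proof eventually_elim
    case (elim n)
    note b = bnd[OF elim]
    have "ln (fact (n div k)) \<le> real (n div k) * ln (n div k) - (n div k) + ln (n div k) + 1"
      using b by (intro ln_fact_bounds) linarith
    also have "real (n div k) * ln (n div k) - (n div k) \<le> ?x n * ln (?x n) - ?x n"
      using b by (intro mono_x_ln_x) auto
    also have "ln (real (n div k)) \<le> ln (?x n)" using b by (subst ln_le_cancel_iff) linarith+
    finally show ?case by (intro diff_right_mono divide_right_mono) auto
  qed
qed

text \<open>This is Chebyshev's constant (ln 2)/2 + (ln 3)/3 + (ln 5)/5 - (ln 30)/30, about 0.9213,
  written with a common denominator.\<close>

definition chebyshev_const :: real where
  "chebyshev_const = (14 * ln 2 + 9 * ln 3 + 5 * ln 5) / 30"

text \<open>The divergent terms \<open>ln n / k\<close> cancel because 1 - 1/2 - 1/3 - 1/5 + 1/30 =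
  0, so only the constants of \<open>ln_fact_div_limit\<close> survive.\<close>

lemma factorial_ratio_limit: "(\<lambda>n. ln_factorial_ratio n / n) \<longlonglongrightarrow> chebyshev_const"
proof -
  let ?t = "\<lambda>k n. ln (fact (n div k)) / real n - ln n / real k"
  have "(\<lambda>n. ?t 1 n - ?t 2 n - ?t 3 n - ?t 5 n + ?t 30 n) \<longlonglongrightarrow> 
    - (1 + ln (real 1)) / real 1 - - (1 + ln (real 2)) / real 2 - - (1 + ln (real 3)) / real 3
    - - (1 + ln (real 5)) / real 5 + - (1 + ln (real 30)) / real 30"
    by (intro tendsto_intros ln_fact_div_limit) auto
  also have "(\<lambda>n. ?t 1 n - ?t 2 n - ?t 3 n - ?t 5 n + ?t 30 n) = (\<lambda>n. ln_factorial_ratio n / n)"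
    by (auto simp: ln_factorial_ratio_def add_divide_distrib diff_divide_distrib)
  also have "ln (real 30) = ln 2 + ln 3 + ln 5"
    using ln_mult[of 2 3] ln_mult[of 6 5] by simp
  also have "- (1 + ln (real 1)) / real 1 - - (1 + ln (real 2)) / real 2 - - (1 + ln (real 3)) / real 3
    - - (1 + ln (real 5)) / real 5 + - (1 + (ln 2 + ln 3 + ln 5)) / real 30 = chebyshev_const"
    unfolding chebyshev_const_def by (simp add: field_simps)
  finally show ?thesis .
qed

lemma chebyshev_const_bounds: "9/10 < chebyshev_const" "chebyshev_const < 28/30"
proof -
  have eq: "30 * chebyshev_const = ln (2^14 * 3^9 * 5^5)"
    by (simp add: chebyshev_const_def ln_mult ln_realpow del: power_numeral power_numeral_reduce)
  have "exp (27::real) = exp 1 ^ 27" by (simp flip: exp_of_nat_mult)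
  also have "\<dots> < (272/100) ^ 27" by (intro power_strict_mono e_less_272) auto
  also have "\<dots> < 2^14 * 3^9 * 5^5" by (simp add: power_divide)
  finally have "27 < ln (2^14 * 3^9 * 5^5 :: real)" by (subst ln_exp[symmetric], subst ln_less_cancel_iff) auto
  then show "9/10 < chebyshev_const" using eq by simp
  \<comment> \<open>The quadratic Taylor bound for exp is too weak at 1 but accurate enough at 1/4,
    hence 112 = 4 * 28 factors.\<close>
  have "(2^14 * 3^9 * 5^5 :: real) < (1 + 1/4 + (1/4)^2/2) ^ 112" by (simp add: power_divide)
  also have "\<dots> \<le> exp (1/4) ^ 112" by (intro power_mono exp_lower_Taylor_quadratic) auto
  also have "\<dots> = exp 28" by (simp flip: exp_of_nat_mult)
  finally have "ln (2^14 * 3^9 * 5^5 :: real) < 28" by (subst ln_exp[symmetric], subst ln_less_cancel_iff) auto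
  then show "chebyshev_const < 28/30" using eq by simp
qed

section \<open>Bounds for psi and theta\<close>

lemma chebyshev_psi_mono: "m \<le> n \<Longrightarrow> chebyshev_psi m \<le> chebyshev_psi n"
  unfolding chebyshev_psi_def by (intro sum_mono2) (auto simp: mangoldt_nonneg)

text \<open>Iterating the bound from \<open>n\<close> to \<open>n div 6\<close> gives a geometric
  series with total 28/30 * 6/5 = 112/100. The remaining 1/100 absorbs the constant
  \<open>chebyshev_psi n0\<close> left by the small arguments.\<close>

lemma chebyshev_psi_upper: "eventually (\<lambda>n. chebyshev_psi n \<le> 113/100 * n) sequentially"
proof -
  have "eventually (\<lambda>n. ln_factorial_ratio n / n < 28/30) sequentially"
    using factorial_ratio_limit chebyshev_const_bounds(2) by (rule order_tendstoD(2))
  then obtain n0 where n0: "\<And>n. n \<ge> n0 \<Longrightarrow> ln_factorial_ratio n / n < 28/30"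
    by (auto simp: eventually_sequentially)
  have bound: "chebyshev_psi n \<le> 112/100 * n + chebyshev_psi n0" for n
  proof (induction n rule: less_induct)
    case (less n)
    show ?case
    proof (cases "n \<le> n0")
      case True
      then show ?thesis using chebyshev_psi_mono[OF True] by simp
    next
      case False
      have "chebyshev_psi n \<le> chebyshev_psi (n div 6) + ln_factorial_ratio n" using chebyshev_psi_diff_le_factorial_ratio[of n] by simp
      also have "chebyshev_psi (n div 6) \<le> 112/100 * real (n div 6) + chebyshev_psi n0" using False by (intro less) auto
      also have "real (n div 6) \<le> n / 6" using of_nat_div_le_of_nat[of n 6, where 'a = real] by simp
      also have "ln_factorial_ratio n \<le> 28/30 * n" using n0[of n] False by (simp add: field_simps)
      finally show ?thesis by (simp add: field_simps)
    qed
  qed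
  have "eventually (\<lambda>n. chebyshev_psi n0 \<le> n / 100) sequentially" by real_asymp
  then show ?thesis
  proof eventually_elim
    case (elim n)
    then show ?case using bound[of n] by simp
  qed
qed

lemma chebyshev_theta_eq: "chebyshev_theta n = (\<Sum>d\<in>{d\<in>{1..n}. prime d}. mangoldt d)"
  unfolding chebyshev_theta_def
proof (rule sum.cong)
  show "{p. prime p \<and> p \<le> n} = {d \<in> {1..n}. prime d}" by (auto simp: prime_ge_1_nat prime_ge_Suc_0_nat)
qed auto

lemma chebyshev_theta_le_chebyshev_psi: "chebyshev_theta n \<le> chebyshev_psi n"
  unfolding chebyshev_theta_eq chebyshev_psi_def by (intro sum_mono2) (auto simp: mangoldt_nonneg)

text \<open>Only powers p^k with k >= 2 contribute. They have p <= sqrt n and k <= log 2 n, and each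
  contributes at most \<open>ln n\<close>; this crude count is already o(n).\<close>

lemma chebyshev_psi_minus_chebyshev_theta_le:
  assumes "n \<ge> 1"
  shows "chebyshev_psi n - chebyshev_theta n \<le> (sqrt n + 1) * (log 2 n + 1) * ln n"
proof -
  define B where "B = {d\<in>{1..n}. primepow d \<and> \<not> prime d}"
  let ?S = "{..nat \<lfloor>sqrt n\<rfloor>} \<times> {..nat \<lfloor>log 2 n\<rfloor>}"
  have "chebyshev_psi n = chebyshev_theta n + (\<Sum>d\<in>{d\<in>{1..n}. \<not> prime d}. mangoldt d)"
    unfolding chebyshev_psi_def chebyshev_theta_eq
    by (subst sum.union_disjoint[symmetric]) (auto intro!: sum.cong)
  also have "(\<Sum>d\<in>{d\<in>{1..n}. \<not> prime d}. mangoldt d) = (\<Sum>d\<in>B. mangoldt d)"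
    unfolding B_def by (intro sum.mono_neutral_right) (auto simp: mangoldt_def)
  also have "\<dots> \<le> (\<Sum>d\<in>B. ln n)"
  proof (rule sum_mono)
    fix d assume "d \<in> B"
    then have d: "1 \<le> d" "d \<le> n" by (auto simp: B_def)
    then have "mangoldt d \<le> ln d" by (intro mangoldt_le) auto
    also have "\<dots> \<le> ln n" using d by (subst ln_le_cancel_iff) auto
    finally show "mangoldt d \<le> ln n" .
  qed
  also have "\<dots> = card B * ln n" by simp
  also have "\<dots> \<le> (sqrt n + 1) * (log 2 n + 1) * ln n"
  proof (rule mult_right_mono)
    have "B \<subseteq> (\<lambda>(p,k). p ^ k) ` ?S"
    proof
      fix d assume "d \<in> B"
      then have d: "d \<le> n" "primepow d" "\<not> prime d" by (auto simp: B_def)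
      from d(2) obtain p k where pk: "prime p" "k > 0" "d = p ^ k" by (auto simp: primepow_def)
      have "k \<noteq> 1" using pk d by auto
      with pk have k2: "k \<ge> 2" by simp
      have p2: "p \<ge> 2" using pk by (simp add: prime_ge_2_nat)
      have "p ^ 2 \<le> p ^ k" using k2 p2 by (intro power_increasing) auto
      then have "p ^ 2 \<le> n" using pk d by simp
      then have "real p ^ 2 \<le> real n" by (metis of_nat_le_iff of_nat_power)
      then have "real p \<le> sqrt n" by (rule real_le_rsqrt)
      then have "p \<le> nat \<lfloor>sqrt n\<rfloor>" by (simp add: le_nat_floor)
      moreover have "2 ^ k \<le> p ^ k" using p2 by (intro power_mono) auto
      then have "2 ^ k \<le> n" using pk d by linarith
      then have "real k \<le> log 2 n" using assms by (intro le_log_of_power) auto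
      then have "k \<le> nat \<lfloor>log 2 n\<rfloor>" by (simp add: le_nat_floor)
      ultimately show "d \<in> (\<lambda>(p,k). p ^ k) ` ?S" using pk by auto
    qed
    then have "card B \<le> card ?S" by (rule surj_card_le[rotated]) auto
    then have "card B \<le> (nat \<lfloor>sqrt n\<rfloor> + 1) * (nat \<lfloor>log 2 n\<rfloor> + 1)" by (simp add: card_cartesian_product)
    then have "real (card B) \<le> real ((nat \<lfloor>sqrt n\<rfloor> + 1) * (nat \<lfloor>log 2 n\<rfloor> + 1))"
      by (simp only: of_nat_le_iff)
    also have "\<dots> = (real (nat \<lfloor>sqrt n\<rfloor>) + 1) * (real (nat \<lfloor>log 2 n\<rfloor>) + 1)"
      by (simp only: of_nat_mult of_nat_add of_nat_1)
    also have "\<dots> \<le> (sqrt n + 1) * (log 2 n + 1)"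
      using assms by (intro mult_mono add_mono) auto
    finally show "real (card B) \<le> (sqrt n + 1) * (log 2 n + 1)" .
  qed (use assms in auto)
  finally show ?thesis by simp
qed

lemma chebyshev_theta_lower: "eventually (\<lambda>n. 9/10 * n \<le> chebyshev_theta n) sequentially"
proof -
  \<comment> \<open>The midpoint leaves a linear amount of room on either side: below the limit of
    the ratio, and above 9/10 for the proper prime powers.\<close>
  define a where "a = (9/10 + chebyshev_const) / 2"
  have a: "9/10 < a" "a < chebyshev_const" using chebyshev_const_bounds(1) by (auto simp: a_def)
  have "eventually (\<lambda>n. a < ln_factorial_ratio n / n) sequentially"
    using factorial_ratio_limit a(2) by (rule order_tendstoD(1))
  moreover have "eventually (\<lambda>n. (sqrt n + 1) * (log 2 n + 1) * ln n \<le> (a - 9/10) * n) sequentially"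
    using a(1) by real_asymp
  moreover have "eventually (\<lambda>n::nat. n \<ge> 1) sequentially" by (rule eventually_ge_at_top)
  ultimately show ?thesis
  proof eventually_elim
    case (elim n)
    have "a * n \<le> ln_factorial_ratio n" using elim by (simp add: field_simps)
    also have "\<dots> \<le> chebyshev_psi n" by (rule factorial_ratio_le_chebyshev_psi)
    finally have "a * n \<le> chebyshev_psi n" .
    moreover have "chebyshev_psi n - chebyshev_theta n \<le> (a - 9/10) * n"
      using chebyshev_psi_minus_chebyshev_theta_le[of n] elim by linarith
    ultimately show ?case by (simp add: algebra_simps)
  qed
qed

lemma chebyshev_theta_Suc: "chebyshev_theta (Suc n) = chebyshev_theta n + (if prime (Suc n) then ln (Suc n) else 0)"
proof -
  have "{p. prime p \<and> p \<le> Suc n} = (if prime (Suc n) then insert (Suc n) {p. prime p \<and> p \<le> n} else {p. prime p \<and> p \<le> n})"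
    by (auto simp: le_Suc_eq)
  then show ?thesis by (simp add: chebyshev_theta_def)
qed

section \<open>Sums over the primes in (y, 10y]\<close>

definition primes_between :: "nat \<Rightarrow> nat \<Rightarrow> nat set" where
  "primes_between m n = {p. prime p \<and> m < p \<and> p \<le> n}"

lemma finite_primes_between [simp]: "finite (primes_between m n)"
  by (rule finite_subset[of _ "{..n}"]) (auto simp: primes_between_def)

text \<open>Partial summation carried out as an induction on \<open>m\<close>, with the boundary
  terms at \<open>y\<close> and \<open>m\<close> kept in the statement. The main term telescopes
  through 1/(m+1) - 1/(m+2) <= 1/(m+1)^2.\<close>

lemma sum_ln_prime_over_square_lower:
  assumes lower: "\<And>n. n \<ge> y \<Longrightarrow> a * n \<le> chebyshev_theta n" and "a \<ge> 0" and "y \<le> m"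
  shows "(\<Sum>p\<in>primes_between y m. ln p / real p ^ 2) \<ge>
    a * (1 / (y + 1) - 1 / (m + 1)) - (chebyshev_theta y - a * y) / (real y + 1) ^ 2 + (chebyshev_theta m - a * m) / (real m + 1) ^ 2"
  using \<open>y \<le> m\<close>
proof (induction m rule: dec_induct)
  case base
  have "primes_between y y = {}" by (auto simp: primes_between_def)
  then show ?case by simp
next
  case (step m)
  define t where "t = (if prime (Suc m) then ln (Suc m) else 0)"
  define e where "e = chebyshev_theta (Suc m) - a * Suc m"
  have e: "e \<ge> 0" using lower[of "Suc m"] step.hyps by (simp add: e_def)
  have t: "t = e - (chebyshev_theta m - a * m) + a"
    by (simp add: t_def e_def chebyshev_theta_Suc algebra_simps)
  have "primes_between y (Suc m) = (if prime (Suc m) then insert (Suc m) (primes_between y m) else primes_between y m)"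
    using step.hyps by (auto simp: primes_between_def le_Suc_eq)
  moreover have "Suc m \<notin> primes_between y m" by (auto simp: primes_between_def)
  ultimately have "(\<Sum>p\<in>primes_between y (Suc m). ln p / real p ^ 2) = t / (real m + 1) ^ 2 + (\<Sum>p\<in>primes_between y m. ln p / real p ^ 2)"
    by (simp add: t_def add.commute)
  moreover have "t / (real m + 1) ^ 2 = e / (real m + 1) ^ 2 + a / (real m + 1) ^ 2 - (chebyshev_theta m - a * m) / (real m + 1) ^ 2"
    unfolding t by (simp add: add_divide_distrib diff_divide_distrib)
  \<comment> \<open>The hypothesis \<open>lower\<close> enters here: the boundary term is
    nonnegative, so its denominator may be enlarged.\<close>
  moreover have "e / (real m + 2) ^ 2 \<le> e / (real m + 1) ^ 2"
    using e by (intro divide_left_mono power_mono) auto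
  moreover have "a * (1 / (real m + 1) - 1 / (real m + 2)) \<le> a / (real m + 1) ^ 2"
  proof -
    have "1 / (real m + 1) - 1 / (real m + 2) \<le> 1 / (real m + 1) ^ 2"
    proof -
      have "1 / (real m + 1) - 1 / (real m + 2) = 1 / ((real m + 1) * (real m + 2))"
        by (simp add: field_simps)
      also have "\<dots> \<le> 1 / (real m + 1) ^ 2"
        unfolding power2_eq_square by (intro divide_left_mono mult_left_mono) auto
      finally show ?thesis .
    qed
    then have "a * (1 / (real m + 1) - 1 / (real m + 2)) \<le> a * (1 / (real m + 1) ^ 2)"
      using \<open>a \<ge> 0\<close> by (rule mult_left_mono)
    then show ?thesis by simp
  qed
  moreover have "real (Suc m) + 1 = real m + 2" by simp
  ultimately show ?case using step.IH
    unfolding e_def[symmetric] by (simp only: right_diff_distrib)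
qed

text \<open>To leading order in 1/y the coefficient is 9/10 * (1 - 1/10) - (113/100 - 9/10) =
  58/100. The surplus over 57/100 pays for the shifts by 1 in the denominators.\<close>

lemma sum_ln_prime_over_square:
  "eventually (\<lambda>y. (\<Sum>p\<in>primes_between y (10 * y). ln p / real p ^ 2) \<ge> 57/100 / y) sequentially"
proof -
  obtain n0 where n0: "\<And>n. n \<ge> n0 \<Longrightarrow> 9/10 * n \<le> chebyshev_theta n"
    using chebyshev_theta_lower by (auto simp: eventually_sequentially)
  have "eventually (\<lambda>y::nat. y \<ge> n0) sequentially" by (rule eventually_ge_at_top)
  moreover have "eventually (\<lambda>y::nat. 57/100 / real y \<le> 9/10 * (1 / (real y + 1) - 1 / (10 * real y + 1)) - 23/100 * real y / (real y + 1) ^ 2) sequentially"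
    by real_asymp
  ultimately show ?thesis using chebyshev_psi_upper
  proof eventually_elim
    case (elim y)
    have "chebyshev_theta y - 9/10 * y \<le> 23/100 * real y"
      using chebyshev_theta_le_chebyshev_psi[of y] elim by simp
    then have "(chebyshev_theta y - 9/10 * y) / (real y + 1) ^ 2 \<le> 23/100 * real y / (real y + 1) ^ 2"
      by (rule divide_right_mono) simp
    moreover have "(chebyshev_theta (10 * y) - 9/10 * real (10 * y)) / (10 * real y + 1) ^ 2 \<ge> 0"
      using n0[of "10 * y"] elim by auto
    moreover have "9/10 * (1 / (real y + 1) - 1 / (real (10 * y) + 1)) - (chebyshev_theta y - 9/10 * y) / (real y + 1) ^ 2
        + (chebyshev_theta (10 * y) - 9/10 * real (10 * y)) / (real (10 * y) + 1) ^ 2 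
        \<le> (\<Sum>p\<in>primes_between y (10 * y). ln p / real p ^ 2)"
      using elim by (intro sum_ln_prime_over_square_lower n0) auto
    moreover have "real (10 * y) = 10 * real y" by simp
    ultimately show ?case
      using elim(2) by simp
  qed
qed

text \<open>Each 1/p is at most \<open>ln p / (y * ln y)\<close>, and theta at 10y is at most 11.3
  y. The sum therefore tends to 0, which makes the second-order Bonferroni term negligible.\<close>

lemma sum_inverse_prime_le:
  "eventually (\<lambda>y. (\<Sum>p\<in>primes_between y (10 * y). 1 / p) \<le> 12 / ln y) sequentially"
proof -
  obtain n0 where n0: "\<And>n. n \<ge> n0 \<Longrightarrow> chebyshev_psi n \<le> 113/100 * n"
    using chebyshev_psi_upper by (auto simp: eventually_sequentially)
  have "eventually (\<lambda>y::nat. y \<ge> max n0 2) sequentially" by (rule eventually_ge_at_top)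
  then show ?thesis
  proof eventually_elim
    case (elim y)
    then have y: "y \<ge> n0" "y \<ge> 2" by auto
    have "(\<Sum>p\<in>primes_between y (10 * y). 1 / p) \<le> (\<Sum>p\<in>primes_between y (10 * y). ln p / (y * ln y))"
    proof (rule sum_mono)
      fix p assume "p \<in> primes_between y (10 * y)"
      then have p: "y < p" by (auto simp: primes_between_def)
      have "real y * ln y \<le> p * ln p" using p y by (intro mult_mono) auto
      then show "1 / real p \<le> ln p / (y * ln y)" using p y by (simp add: field_simps)
    qed
    also have "\<dots> = (\<Sum>p\<in>primes_between y (10 * y). ln p) / (y * ln y)"
      by (simp add: sum_divide_distrib)
    also have "\<dots> \<le> (12 * y) / (y * ln y)"
    proof (rule divide_right_mono)
      have "(\<Sum>p\<in>primes_between y (10 * y). ln p) \<le> chebyshev_theta (10 * y)"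
        unfolding chebyshev_theta_def
        by (rule sum_mono2) (auto simp: primes_between_def prime_ge_1_nat Suc_leI prime_gt_0_nat)
      also have "\<dots> \<le> chebyshev_psi (10 * y)" by (rule chebyshev_theta_le_chebyshev_psi)
      also have "\<dots> \<le> 12 * y" using n0[of "10 * y"] y by simp
      finally show "(\<Sum>p\<in>primes_between y (10 * y). ln p) \<le> 12 * y" .
    qed (use y in auto)
    finally show ?case using y by simp
  qed
qed

section \<open>Avoiding collisions\<close>

lemma card_multiples: "card {t\<in>{1..n}. d dvd t} = n div d" for n d :: nat
proof (induction n)
  case (Suc n)
  have "{t\<in>{1..Suc n}. d dvd t} = (if d dvd Suc n then insert (Suc n) {t\<in>{1..n}. d dvd t} else {t\<in>{1..n}. d dvd t})"
    by (auto simp: le_Suc_eq)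
  then show ?case using Suc by (simp add: div_Suc dvd_eq_mod_eq_0)
qed simp

lemma sum_dvd_eq: "(\<Sum>t=1..n. of_bool (d dvd t)) = real (n div d)"
proof -
  have "{1..n} \<inter> {t. d dvd t} = {t\<in>{1..n}. d dvd t}" by auto
  then show ?thesis using card_multiples[of n d] by (simp add: sum_of_bool_eq)
qed

text \<open>Two weights matter below: the constant 1, which counts the primes of \<open>S\<close>
  dividing \<open>t\<close>, and 1/p, which gives the weight w of the overview.\<close>

definition dvd_weight :: "(nat \<Rightarrow> real) \<Rightarrow> nat set \<Rightarrow> nat \<Rightarrow> real" where
  "dvd_weight a S t = (\<Sum>p\<in>S. a p * of_bool (p dvd t))"

lemma dvd_weight_sum_lower:
  assumes "\<And>p. p \<in> S \<Longrightarrow> a p \<ge> 0" "\<And>p. p \<in> S \<Longrightarrow> p > 0"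
  shows "(\<Sum>t=1..n. dvd_weight a S t) \<ge> n * (\<Sum>p\<in>S. a p / p) - sum a S"
proof -
  have "(\<Sum>t=1..n. dvd_weight a S t) = (\<Sum>p\<in>S. a p * real (n div p))"
    unfolding dvd_weight_def by (subst sum.swap) (simp only: sum_distrib_left[symmetric] sum_dvd_eq)
  also have "\<dots> \<ge> (\<Sum>p\<in>S. a p * (n / p - 1))"
  proof (intro sum_mono mult_left_mono)
    fix p assume "p \<in> S"
    then have "p > 0" by (rule assms)
    then have "n < p + p * (n div p)" by (intro dividend_less_times_div)
    then have "real n < real p + real p * real (n div p)"
      by (metis of_nat_add of_nat_less_iff of_nat_mult)
    then show "n / p - 1 \<le> real (n div p)" using \<open>p > 0\<close> by (simp add: pos_divide_le_eq algebra_simps)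
  qed (use assms in auto)
  also have "(\<Sum>p\<in>S. a p * (n / p - 1)) = n * (\<Sum>p\<in>S. a p / p) - sum a S"
    by (simp add: sum_distrib_left sum_subtractf algebra_simps)
  finally show ?thesis .
qed

text \<open>Expand the product: distinct primes p, q are coprime and jointly divide
  \<open>n div (p * q)\<close> numbers, while the diagonal p = q produces the sum over
  \<open>S \<inter> Q\<close>.\<close>

lemma dvd_weight_prod_sum_upper:
  assumes fin: "finite S" "finite Q" and pr: "\<And>p. p \<in> S \<union> Q \<Longrightarrow> prime p"
    and a: "\<And>p. p \<in> S \<Longrightarrow> a p \<ge> 0" and b: "\<And>p. p \<in> Q \<Longrightarrow> b p \<ge> 0"
  shows "(\<Sum>t=1..n. dvd_weight a S t * dvd_weight b Q t) \<le>
    n * ((\<Sum>p\<in>S. a p / p) * (\<Sum>q\<in>Q. b q / q) + (\<Sum>p\<in>S\<inter>Q. a p * b p / p))"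
proof -
  have count: "(\<Sum>t=1..n. of_bool (p dvd t) * of_bool (q dvd t)) \<le> n * (1 / (real p * real q) + of_bool (p = q) / p)"
    if "prime p" "prime q" for p q :: nat
  proof (cases "p = q")
    case True
    have "(\<Sum>t=1..n. of_bool (p dvd t) * of_bool (q dvd t)) = real (n div p)"
      unfolding sum_dvd_eq[symmetric] using True by (intro sum.cong) auto
    also have "\<dots> \<le> n / p" by (rule of_nat_div_le_of_nat)
    also have "\<dots> = n * (1 / p)" by simp
    also have "\<dots> \<le> n * (1 / (real p * real q) + of_bool (p = q) / p)"
      using True by (intro mult_left_mono) auto
    finally show ?thesis .
  next
    case False
    then have "coprime p q" using that by (simp add: primes_coprime)
    then have "(\<Sum>t=1..n. of_bool (p dvd t) * of_bool (q dvd t)) = (\<Sum>t=1..n. of_bool (p * q dvd t) :: real)"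
      by (intro sum.cong) (auto intro: divides_mult dest: dvd_mult_left dvd_mult_right)
    also have "\<dots> = real (n div (p * q))" by (rule sum_dvd_eq)
    also have "\<dots> \<le> real n / real (p * q)" by (rule of_nat_div_le_of_nat)
    finally show ?thesis using False by simp
  qed
  have "(\<Sum>t=1..n. dvd_weight a S t * dvd_weight b Q t) =
    (\<Sum>t=1..n. \<Sum>p\<in>S. \<Sum>q\<in>Q. a p * b q * (of_bool (p dvd t) * of_bool (q dvd t)))"
    unfolding dvd_weight_def sum_product by (intro sum.cong) auto
  also have "\<dots> = (\<Sum>p\<in>S. \<Sum>t=1..n. \<Sum>q\<in>Q. a p * b q * (of_bool (p dvd t) * of_bool (q dvd t)))"
    by (rule sum.swap)
  also have "\<dots> = (\<Sum>p\<in>S. \<Sum>q\<in>Q. a p * b q * (\<Sum>t=1..n. of_bool (p dvd t) * of_bool (q dvd t)))"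
    by (rule sum.cong[OF refl], subst sum.swap) (simp only: sum_distrib_left)
  also have "\<dots> \<le> (\<Sum>p\<in>S. \<Sum>q\<in>Q. a p * b q * (n * (1 / (real p * real q) + of_bool (p = q) / p)))"
    using count pr a b by (intro sum_mono mult_left_mono) auto
  also have "\<dots> = n * ((\<Sum>p\<in>S. \<Sum>q\<in>Q. (a p / p) * (b q / q)) + (\<Sum>p\<in>S. \<Sum>q\<in>Q. if p = q then a p * b p / p else 0))"
    unfolding sum_distrib_left sum.distrib[symmetric] by (intro sum.cong refl) (auto simp: field_simps)
  also have "(\<Sum>p\<in>S. \<Sum>q\<in>Q. if p = q then a p * b p / p else 0) = (\<Sum>p\<in>S. if p \<in> Q then a p * b p / p else 0)"
    using fin by (intro sum.cong refl) (simp add: sum.delta')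
  also have "\<dots> = (\<Sum>p\<in>S\<inter>Q. a p * b p / p)"
    using fin by (simp add: sum.inter_restrict)
  also have "(\<Sum>p\<in>S. \<Sum>q\<in>Q. (a p / p) * (b q / q)) = (\<Sum>p\<in>S. a p / p) * (\<Sum>q\<in>Q. b q / q)"
    by (simp add: sum_product)
  finally show ?thesis .
qed

section \<open>The bound for one draw\<close>

text \<open>The product of 1 - x + x^2/2 and 1 + x + x^2/2 is 1 + x^4/4, hence at least 1.\<close>

lemma exp_minus_le_quadratic:
  assumes "x \<ge> 0" shows "exp (- x) \<le> 1 - x + x ^ 2 / (2::real)"
proof -
  have "exp x \<ge> 1 + x + x\<^sup>2 / 2" using assms by (rule exp_lower_Taylor_quadratic)
  moreover have "0 < 1 + x + x\<^sup>2 / 2" using assms by (simp add: add_pos_nonneg)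
  ultimately have "exp (- x) \<le> 1 / (1 + x + x\<^sup>2 / 2)"
    unfolding exp_minus by (simp add: inverse_eq_divide frac_le)
  also have "\<dots> \<le> 1 - x + x ^ 2 / 2"
  proof -
    have "(1 - x + x ^ 2 / 2) * (1 + x + x\<^sup>2 / 2) = 1 + (x\<^sup>2)\<^sup>2 / 4"
      by (simp add: power2_eq_square algebra_simps)
    then have "1 \<le> (1 - x + x ^ 2 / 2) * (1 + x + x\<^sup>2 / 2)" by simp
    then show ?thesis using \<open>0 < _\<close> by (simp add: pos_divide_le_eq)
  qed
  finally show ?thesis .
qed

text \<open>The second Bonferroni inequality merged with the quadratic bound for exp. With
  \<open>x\<close> a multiple of the 1/p weight, the right side is a quadratic polynomial in the two
  weights, so its sum over \<open>t\<close> needs only first and second moments.\<close>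

lemma avoidance_pointwise:
  fixes x :: real and S :: "nat set" and t :: nat
  assumes "finite S" "x \<ge> 0"
  defines "A \<equiv> dvd_weight (\<lambda>_. 1) S t"
  shows "of_bool (\<forall>p\<in>S. \<not> p dvd t) * exp (- x) \<le> 1 - A + (A * A - A) / 2 - x + x * A + x ^ 2 / 2"
proof -
  have A: "A = real (card {p\<in>S. p dvd t})"
    unfolding A_def dvd_weight_def using assms(1) by (simp add: sum_of_bool_eq Collect_conj_eq Int_commute)
  show ?thesis
  proof (cases "\<forall>p\<in>S. \<not> p dvd t")
    case True
    then have "{p\<in>S. p dvd t} = {}" by auto
    then have "A = 0" unfolding A by (simp only: card.empty)
    then show ?thesis using exp_minus_le_quadratic[OF assms(2)] True by simp
  next
    case False
    then have "card {p\<in>S. p dvd t} \<noteq> 0" using assms(1) by auto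
    then have "A \<ge> 1" unfolding A by linarith
    \<comment> \<open>Integrality of \<open>A\<close> is essential: the product is negative strictly
      between 1 and 2.\<close>
    have "(A - 1) * (A - 2) \<ge> 0"
    proof (cases "card {p\<in>S. p dvd t} = 1")
      case False
      then have "A \<ge> 2" using \<open>card _ \<noteq> 0\<close> unfolding A by linarith
      then show ?thesis by simp
    qed (simp add: A)
    moreover have "x * (A - 1) \<ge> 0" using \<open>A \<ge> 1\<close> assms(2) by simp
    moreover have "1 - A + (A * A - A) / 2 - x + x * A + x ^ 2 / 2 = (A - 1) * (A - 2) / 2 + x * (A - 1) + x ^ 2 / 2"
      by (simp add: field_simps)
    ultimately have "0 \<le> 1 - A + (A * A - A) / 2 - x + x * A + x ^ 2 / 2"
      by simp
    moreover have "of_bool (\<forall>p\<in>S. \<not> p dvd t) = (0 :: real)" using False by (simp only: of_bool_def if_False)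
    ultimately show ?thesis by (simp only: mult_zero_left)
  qed
qed

definition inverse_sum :: "nat \<Rightarrow> nat set \<Rightarrow> real" where
  "inverse_sum k P = (\<Sum>p\<in>P. 1 / real p ^ k)"

text \<open>The loss per draw: the first summand comes from rounding X/p down to an integer, the
  second from the quadratic term of the exponential.\<close>

definition error_term :: "nat set \<Rightarrow> nat \<Rightarrow> nat \<Rightarrow> real \<Rightarrow> real" where
  "error_term P y X N = (2 + N) * card P / X + N ^ 2 / 2 * (inverse_sum 2 P ^ 2 + inverse_sum 2 P / y)"

lemma inverse_sum_nonneg: "inverse_sum k P \<ge> 0"
  unfolding inverse_sum_def by (intro sum_nonneg) auto

lemma inverse_sum_mono: "finite P \<Longrightarrow> S \<subseteq> P \<Longrightarrow> inverse_sum k S \<le> inverse_sum k P"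
  unfolding inverse_sum_def by (intro sum_mono2) auto

lemma inverse_sum_Suc_le:
  assumes "y > 0" "\<And>p. p \<in> P \<Longrightarrow> y < p"
  shows "inverse_sum (Suc k) P \<le> inverse_sum k P / y"
  unfolding inverse_sum_def sum_divide_distrib
proof (rule sum_mono)
  fix p assume "p \<in> P"
  then have "y < p" by (rule assms)
  then show "1 / real p ^ Suc k \<le> 1 / real p ^ k / real y"
    using assms(1) by (simp add: frac_le)
qed

text \<open>Sum \<open>avoidance_pointwise\<close> over \<open>t\<close> with \<open>x\<close> equal
  to \<open>s\<close> times the 1/p weight. The corrections proportional to
  \<open>inverse_sum 1 S\<close> only lower its coefficient from 1 to \<open>c\<close>; all others
  are collected in \<open>error_term\<close>.\<close>

lemma avoidance_step:
  fixes P S :: "nat set" and X y :: nat and s N c :: real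
  assumes fin: "finite P" and P: "\<And>p. p \<in> P \<Longrightarrow> prime p \<and> y < p" and SP: "S \<subseteq> P"
    and s: "0 \<le> s" "s \<le> N" and y: "y > 0" and X: "X > 0"
    and c: "c \<le> 1 - inverse_sum 1 P / 2 - N * (inverse_sum 2 P + 1 / y)"
  shows "(\<Sum>t\<in>{t\<in>{1..X}. \<forall>p\<in>S. \<not> p dvd t}. exp (- (s * dvd_weight (\<lambda>p. 1 / p) P t)))
    \<le> X * exp (- c * inverse_sum 1 S - s * inverse_sum 2 P + error_term P y X N)"
proof -
  define Z \<sigma> R where "Z = inverse_sum 1 S" and "\<sigma> = inverse_sum 2 P" and "R = inverse_sum 1 P"
  let ?A = "dvd_weight (\<lambda>_. 1) S" and ?w = "dvd_weight (\<lambda>p. 1 / p) P"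
  note nonneg = inverse_sum_nonneg
  have finS: "finite S" using SP fin by (rule finite_subset)
  have Z: "0 \<le> Z" "Z \<le> R"
    unfolding Z_def R_def using nonneg inverse_sum_mono[OF fin SP] by auto
  have cardS: "card S \<le> card P" using fin SP by (rule card_mono)
  have S1: "(\<Sum>t=1..X. ?A t) \<ge> X * Z - card S"
    using dvd_weight_sum_lower[of S "\<lambda>_. 1" X] P SP y by (force simp: Z_def inverse_sum_def)
  have S2: "(\<Sum>t=1..X. ?A t * ?A t) \<le> X * (Z * Z + Z)"
    using dvd_weight_prod_sum_upper[of S S "\<lambda>_. 1" "\<lambda>_. 1" X] P SP finS
    by (force simp: Z_def inverse_sum_def)
  have W1: "(\<Sum>t=1..X. ?w t) \<ge> X * \<sigma> - card P"
  proof -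
    have "(\<Sum>p\<in>P. 1 / real p) \<le> (\<Sum>p\<in>P. 1)"
      using P y by (intro sum_mono) (force simp: divide_le_eq)
    moreover have "(\<Sum>t=1..X. ?w t) \<ge> X * (\<Sum>p\<in>P. 1 / real p / p) - (\<Sum>p\<in>P. 1 / real p)"
      using P y by (intro dvd_weight_sum_lower) force+
    ultimately show ?thesis by (simp add: \<sigma>_def inverse_sum_def power2_eq_square)
  qed
  have WA: "(\<Sum>t=1..X. ?w t * ?A t) \<le> X * (Z * \<sigma> + Z / y)"
  proof -
    have "(\<Sum>t=1..X. ?A t * ?w t) \<le> X * ((\<Sum>p\<in>S. 1 / real p) * (\<Sum>p\<in>P. 1 / real p / p) + (\<Sum>p\<in>S\<inter>P. 1 * (1 / real p) / p))"
      using P SP fin finS by (intro dvd_weight_prod_sum_upper) auto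
    also have "\<dots> = X * (Z * \<sigma> + inverse_sum 2 S)"
      using SP by (simp add: Z_def \<sigma>_def inverse_sum_def power2_eq_square Int_absorb2)
    also have "inverse_sum 2 S \<le> Z / y"
      unfolding Z_def using inverse_sum_Suc_le[of y S 1] y P SP by (auto simp: numeral_2_eq_2)
    finally show ?thesis by (simp add: mult.commute mult_left_mono)
  qed
  have W2: "(\<Sum>t=1..X. ?w t * ?w t) \<le> X * (\<sigma> * \<sigma> + \<sigma> / y)"
  proof -
    have "(\<Sum>t=1..X. ?w t * ?w t) \<le> X * ((\<Sum>p\<in>P. 1 / real p / p) * (\<Sum>p\<in>P. 1 / real p / p) + (\<Sum>p\<in>P\<inter>P. (1 / real p) * (1 / real p) / p))"
      using P fin by (intro dvd_weight_prod_sum_upper) auto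
    also have "\<dots> = X * (\<sigma> * \<sigma> + inverse_sum 3 P)"
      by (simp add: \<sigma>_def inverse_sum_def power2_eq_square power3_eq_cube)
    also have "inverse_sum 3 P \<le> \<sigma> / y"
      unfolding \<sigma>_def using inverse_sum_Suc_le[of y P 2] y P by (auto simp: eval_nat_numeral)
    finally show ?thesis by (simp add: mult_left_mono)
  qed
  have w0: "?w t \<ge> 0" for t unfolding dvd_weight_def by (intro sum_nonneg) auto
  have "(\<Sum>t\<in>{t\<in>{1..X}. \<forall>p\<in>S. \<not> p dvd t}. exp (- (s * ?w t)))
    = (\<Sum>t=1..X. of_bool (\<forall>p\<in>S. \<not> p dvd t) * exp (- (s * ?w t)))"
    by (intro sum.mono_neutral_cong_left) auto
  also have "\<dots> \<le> (\<Sum>t=1..X. 1 - ?A t + (?A t * ?A t - ?A t) / 2 - s * ?w t + s * (?w t * ?A t) + s ^ 2 * (?w t * ?w t) / 2)"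
  proof (rule sum_mono)
    fix t
    have "s * ?w t \<ge> 0" using s w0 by simp
    from avoidance_pointwise[OF finS this, of t]
    show "of_bool (\<forall>p\<in>S. \<not> p dvd t) * exp (- (s * ?w t)) \<le>
      1 - ?A t + (?A t * ?A t - ?A t) / 2 - s * ?w t + s * (?w t * ?A t) + s ^ 2 * (?w t * ?w t) / 2"
      by (simp only: power2_eq_square mult_ac)
  qed
  also have "\<dots> = X - (\<Sum>t=1..X. ?A t) + ((\<Sum>t=1..X. ?A t * ?A t) - (\<Sum>t=1..X. ?A t)) / 2
    - s * (\<Sum>t=1..X. ?w t) + s * (\<Sum>t=1..X. ?w t * ?A t) + s ^ 2 * (\<Sum>t=1..X. ?w t * ?w t) / 2"
    by (simp add: sum.distrib sum_subtractf flip: sum_distrib_left sum_divide_distrib)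
  \<comment> \<open>First moments occur with a negative sign and need lower bounds; second moments
    occur with a positive sign and need upper bounds.\<close>
  also have "\<dots> \<le> X - (X * Z - card S) + (X * (Z * Z + Z) - (X * Z - card S)) / 2
    - s * (X * \<sigma> - card P) + s * (X * (Z * \<sigma> + Z / y)) + s ^ 2 * (X * (\<sigma> * \<sigma> + \<sigma> / y)) / 2"
    using s by (intro add_mono diff_mono divide_right_mono mult_left_mono S1 S2 W1 WA W2) auto
  also have "\<dots> = X * (1 - Z + Z * Z / 2 - s * \<sigma> + s * (Z * (\<sigma> + 1 / y)) + s ^ 2 / 2 * (\<sigma> ^ 2 + \<sigma> / y))
      + (3/2 * card S + s * card P)"
    by (simp add: power2_eq_square field_simps)
  also have "\<dots> \<le> X * (1 - Z + Z * R / 2 - s * \<sigma> + N * (Z * (\<sigma> + 1 / y)) + N ^ 2 / 2 * (\<sigma> ^ 2 + \<sigma> / y))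
      + (2 + N) * card P"
  proof (rule add_mono)
    \<comment> \<open>Only one factor \<open>Z\<close> is replaced, so that the correction stays
      proportional to \<open>Z\<close>.\<close>
    have 1: "Z * Z \<le> Z * R" using Z by (intro mult_left_mono)
    have 2: "s * (Z * (\<sigma> + 1 / y)) \<le> N * (Z * (\<sigma> + 1 / y))"
      using s Z nonneg by (intro mult_right_mono) (auto simp: \<sigma>_def)
    have 3: "s ^ 2 / 2 * (\<sigma> ^ 2 + \<sigma> / y) \<le> N ^ 2 / 2 * (\<sigma> ^ 2 + \<sigma> / y)"
      using s nonneg by (intro mult_right_mono divide_right_mono power_mono) (auto simp: \<sigma>_def)
    show "X * (1 - Z + Z * Z / 2 - s * \<sigma> + s * (Z * (\<sigma> + 1 / y)) + s ^ 2 / 2 * (\<sigma> ^ 2 + \<sigma> / y))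
      \<le> X * (1 - Z + Z * R / 2 - s * \<sigma> + N * (Z * (\<sigma> + 1 / y)) + N ^ 2 / 2 * (\<sigma> ^ 2 + \<sigma> / y))"
      by (rule mult_left_mono[OF add_mono[OF add_mono[OF diff_right_mono[OF add_left_mono[OF divide_right_mono[OF 1]]] 2] 3]]) auto
    have "3/2 * real (card S) \<le> 2 * card P" using cardS by simp
    moreover have "s * card P \<le> N * card P" using s by (intro mult_right_mono) auto
    ultimately show "3/2 * real (card S) + s * card P \<le> (2 + N) * card P" by (simp add: algebra_simps)
  qed
  also have "\<dots> = X * (1 - Z * (1 - R / 2 - N * (\<sigma> + 1 / y)) - s * \<sigma> + error_term P y X N)"
  proof -
    define V K where "V = \<sigma> + 1 / y" and "K = N ^ 2 / 2 * (\<sigma> ^ 2 + \<sigma> / y)"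
    have "X * error_term P y X N = (2 + N) * card P + X * K"
      using X unfolding error_term_def \<sigma>_def[symmetric] K_def[symmetric] by (simp add: distrib_left)
    then show ?thesis
      unfolding V_def[symmetric] K_def[symmetric] by (simp add: algebra_simps)
  qed
  also have "\<dots> \<le> X * exp (- Z * (1 - R / 2 - N * (\<sigma> + 1 / y)) - s * \<sigma> + error_term P y X N)"
  proof (rule mult_left_mono)
    define Q where "Q = 1 - R / 2 - N * (\<sigma> + 1 / y)"
    show "1 - Z * (1 - R / 2 - N * (\<sigma> + 1 / y)) - s * \<sigma> + error_term P y X N \<le>
      exp (- Z * (1 - R / 2 - N * (\<sigma> + 1 / y)) - s * \<sigma> + error_term P y X N)"
      unfolding Q_def[symmetric] using exp_ge_add_one_self[of "- Z * Q - s * \<sigma> + error_term P y X N"] by linarith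
  qed simp
  also have "\<dots> \<le> X * exp (- c * Z - s * \<sigma> + error_term P y X N)"
  proof -
    have "Z * c \<le> Z * (1 - R / 2 - N * (\<sigma> + 1 / y))"
      using c Z unfolding R_def \<sigma>_def by (intro mult_left_mono) auto
    then show ?thesis by (intro mult_left_mono) (auto simp: mult.commute)
  qed
  finally show ?thesis unfolding Z_def \<sigma>_def .
qed

text \<open>\<open>S\<close> stands for the primes used by the draws that were exposed earlier.\<close>

definition collision_free :: "nat set \<Rightarrow> nat \<Rightarrow> nat \<Rightarrow> nat set \<Rightarrow> (nat \<Rightarrow> nat) set" where
  "collision_free P X m S = {T \<in> PiE {..<m} (\<lambda>_. {1..X}). (\<forall>i<m. \<forall>p\<in>S. \<not> p dvd T i) \<and>
     (\<forall>j<m. \<forall>k<j. \<forall>p\<in>P. \<not> (p dvd T j \<and> p dvd T k))}"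

lemma finite_collision_free [simp]: "finite (collision_free P X m S)"
  unfolding collision_free_def by (rule finite_subset[OF _ finite_PiE[of "{..<m}" "\<lambda>_. {1..X}"]]) auto

text \<open>The draw with index \<open>m\<close> is exposed first. The other \<open>m\<close> draws
  must then avoid its primes from \<open>P\<close> in addition to \<open>S\<close>.\<close>

lemma card_collision_free_Suc_le:
  "card (collision_free P X (Suc m) S) \<le>
    (\<Sum>t\<in>{t\<in>{1..X}. \<forall>p\<in>S. \<not> p dvd t}. card (collision_free P X m (S \<union> {p\<in>P. p dvd t})))"
proof -
  let ?I = "{t\<in>{1..X}. \<forall>p\<in>S. \<not> p dvd t}"
  let ?B = "\<lambda>t. (\<lambda>g. g(m := t)) ` collision_free P X m (S \<union> {p\<in>P. p dvd t})"
  have "collision_free P X (Suc m) S \<subseteq> (\<Union>t\<in>?I. ?B t)"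
  proof
    fix T assume T: "T \<in> collision_free P X (Suc m) S"
    then have "T \<in> PiE {..<Suc m} (\<lambda>_. {1..X})" by (simp add: collision_free_def)
    \<comment> \<open>Resetting the entry to \<open>undefined\<close> is what makes the shortened
      tuple extensional on \<open>{..<m}\<close>.\<close>
    then have T': "T(m := undefined) \<in> PiE {..<m} (\<lambda>_. {1..X})" "T m \<in> {1..X}"
      by (auto simp: PiE_iff extensional_def)
    have avoid: "\<not> p dvd T i" if "i < Suc m" "p \<in> S" for i p
      using T that by (simp add: collision_free_def)
    have coll: "\<not> (p dvd T j \<and> p dvd T k)" if "j < Suc m" "k < j" "p \<in> P" for j k p
      using T that unfolding collision_free_def by blast
    have "T(m := undefined) \<in> collision_free P X m (S \<union> {p\<in>P. p dvd T m})"
      unfolding collision_free_def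
    proof (intro CollectI conjI allI impI ballI)
      fix i p assume "i < m" "p \<in> S \<union> {p\<in>P. p dvd T m}"
      then show "\<not> p dvd (T(m := undefined)) i" using avoid[of i p] coll[of m i p] by auto
    next
      fix j k p assume "j < m" "k < j" "p \<in> P"
      then show "\<not> (p dvd (T(m := undefined)) j \<and> p dvd (T(m := undefined)) k)"
        using coll[of j k p] by simp
    qed (rule T')
    moreover have "T = (T(m := undefined))(m := T m)" by simp
    moreover have "T m \<in> ?I" using T'(2) avoid[of m] by blast
    ultimately show "T \<in> (\<Union>t\<in>?I. ?B t)" by blast
  qed
  then have "card (collision_free P X (Suc m) S) \<le> card (\<Union>t\<in>?I. ?B t)"
    by (intro card_mono) auto
  also have "\<dots> \<le> (\<Sum>t\<in>?I. card (?B t))" by (rule card_UN_le) auto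
  also have "\<dots> \<le> (\<Sum>t\<in>?I. card (collision_free P X m (S \<union> {p\<in>P. p dvd t})))"
    by (intro sum_mono card_image_le) auto
  finally show ?thesis .
qed

text \<open>Induction on \<open>m\<close> for all \<open>S\<close> at once. Exposing
  \<open>t\<close> adds its weight to \<open>inverse_sum 1 S\<close>, so the induction hypothesis
  supplies the factor exp(-c m w(t)). Averaging it by \<open>avoidance_step\<close> with s = c m
  gains \<open>c * m * inverse_sum 2 P\<close>, and these gains add up to the coefficient
  m(m-1)/2.\<close>

lemma card_collision_free_le:
  fixes P S :: "nat set" and X y m :: nat and N c :: real
  assumes fin: "finite P" and P: "\<And>p. p \<in> P \<Longrightarrow> prime p \<and> y < p" and SP: "S \<subseteq> P"
    and m: "m \<le> N" and y: "y > 0" and X: "X > 0" and c0: "0 \<le> c" "c \<le> 1"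
    and c: "c \<le> 1 - inverse_sum 1 P / 2 - N * (inverse_sum 2 P + 1 / y)"
  shows "card (collision_free P X m S) \<le> X ^ m *
    exp (- c * m * inverse_sum 1 S - c * inverse_sum 2 P * (real m * (real m - 1) / 2) + m * error_term P y X N)"
  using SP m
proof (induction m arbitrary: S)
  case 0
  have "card (collision_free P X 0 S) \<le> card (PiE {..<0::nat} (\<lambda>_. {1..X}))"
    by (intro card_mono finite_PiE) (auto simp: collision_free_def)
  then show ?case by simp
next
  case (Suc m)
  let ?I = "{t\<in>{1..X}. \<forall>p\<in>S. \<not> p dvd t}" and ?w = "dvd_weight (\<lambda>p. 1 / p) P"
  let ?\<sigma> = "inverse_sum 2 P" and ?Z = "inverse_sum 1 S" and ?b = "error_term P y X N"
  define F where "F = exp (- c * m * ?Z - c * ?\<sigma> * (real m * (real m - 1) / 2) + m * ?b)"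
  have finS: "finite S" using Suc.prems fin finite_subset by blast
  have inverse_sum_Un: "inverse_sum 1 (S \<union> {p\<in>P. p dvd t}) = ?Z + ?w t" if "t \<in> ?I" for t
  proof -
    \<comment> \<open>Disjointness holds because \<open>t\<close> avoids \<open>S\<close>; it makes
      the inverse sums add exactly.\<close>
    have "S \<inter> {p\<in>P. p dvd t} = {}" using that by auto
    moreover have "(\<Sum>p\<in>{p\<in>P. p dvd t}. 1 / real p) = ?w t"
      unfolding dvd_weight_def using fin by (intro sum.mono_neutral_cong_left) auto
    ultimately show ?thesis
      unfolding inverse_sum_def using finS fin by (subst sum.union_disjoint) auto
  qed
  have "real (card (collision_free P X (Suc m) S)) \<le> (\<Sum>t\<in>?I. real (card (collision_free P X m (S \<union> {p\<in>P. p dvd t}))))"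
    using card_collision_free_Suc_le[of P X m S] by (simp flip: of_nat_sum)
  also have "\<dots> \<le> (\<Sum>t\<in>?I. X ^ m * exp (- c * m * (?Z + ?w t) - c * ?\<sigma> * (real m * (real m - 1) / 2) + m * ?b))"
  proof (rule sum_mono)
    fix t assume t: "t \<in> ?I"
    have "S \<union> {p\<in>P. p dvd t} \<subseteq> P" using Suc.prems by auto
    moreover have "real m \<le> N" using Suc.prems by simp
    ultimately show "real (card (collision_free P X m (S \<union> {p\<in>P. p dvd t})))
      \<le> X ^ m * exp (- c * m * (?Z + ?w t) - c * ?\<sigma> * (real m * (real m - 1) / 2) + m * ?b)"
      using Suc.IH inverse_sum_Un[OF t] by metis
  qed
  also have "\<dots> = X ^ m * F * (\<Sum>t\<in>?I. exp (- (c * m * ?w t)))"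
    unfolding F_def sum_distrib_left mult.assoc exp_add[symmetric]
    by (intro sum.cong refl) (simp add: algebra_simps)
  also have "\<dots> \<le> X ^ m * F * (X * exp (- c * ?Z - c * m * ?\<sigma> + ?b))"
  proof (rule mult_left_mono)
    have "c * m \<le> 1 * real m" using c0 by (intro mult_right_mono) auto
    then have "c * m \<le> N" using Suc.prems by simp
    then show "(\<Sum>t\<in>?I. exp (- (c * m * ?w t))) \<le> X * exp (- c * ?Z - c * m * ?\<sigma> + ?b)"
      using Suc.prems c0 by (intro avoidance_step fin P y X c) auto
  qed (auto simp: F_def)
  also have "\<dots> = X ^ Suc m * exp (- c * Suc m * ?Z - c * ?\<sigma> * (real (Suc m) * (real (Suc m) - 1) / 2) + Suc m * ?b)"
  proof -
    have "- c * Suc m * ?Z - c * ?\<sigma> * (real (Suc m) * (real (Suc m) - 1) / 2) + Suc m * ?b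
      = (- c * m * ?Z - c * ?\<sigma> * (real m * (real m - 1) / 2) + m * ?b) + (- c * ?Z - c * m * ?\<sigma> + ?b)"
      by (simp add: field_simps)
    then show ?thesis unfolding F_def by (simp only: exp_add) (simp add: mult_ac)
  qed
  finally show ?case .
qed

section \<open>From \<open>prob_event\<close> to collision-free tuples\<close>

lemma le_Lambda:
  assumes "prime p" "p dvd a" "p dvd b" "a > 0"
  shows "p \<le> Lambda a b"
proof -
  have "p dvd gcd a b" using assms by simp
  then have "gcd a b \<noteq> 1" using assms(1) by (metis nat_dvd_1_iff_1 not_prime_1)
  moreover have "finite {p. prime p \<and> p dvd a \<and> p dvd b}"
    using assms(4) by (intro finite_subset[OF _ finite_divisors_nat[of a]]) auto
  then have "p \<le> Max {p. prime p \<and> p dvd a \<and> p dvd b}" using assms by (intro Max_ge) auto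
  ultimately show ?thesis by (simp add: Lambda_def)
qed

text \<open>Two draws sharing a prime of \<open>P\<close> force the maximum up to the bound in the
  event, by \<open>large\<close>. The event is therefore contained in \<open>collision_free\<close>
  with \<open>S\<close> empty, and the uniform law turns the count into a probability.\<close>

lemma prob_event_le:
  fixes P :: "nat set" and N y :: nat and c \<alpha> \<theta> :: real
  defines "X \<equiv> nat \<lfloor>exp (\<alpha> * real N)\<rfloor>"
  assumes fin: "finite P" and P: "\<And>p. p \<in> P \<Longrightarrow> prime p \<and> y < p"
    and large: "\<And>p. p \<in> P \<Longrightarrow> real N ^ 2 / ln (real N powr \<theta>) \<le> p"
    and y: "y > 0" and X: "X > 0" and c0: "0 \<le> c" "c \<le> 1"
    and c: "c \<le> 1 - inverse_sum 1 P / 2 - N * (inverse_sum 2 P + 1 / y)"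
  shows "prob_event \<alpha> \<theta> N \<le>
    exp (- c * inverse_sum 2 P * (real N * (real N - 1) / 2) + N * error_term P y X N)"
proof -
  let ?\<Omega> = "sample_space \<alpha> N" and ?E = "{T. real (Max {Lambda (T j) (T k) | j k. k < j \<and> j < N}) < real N ^ 2 / ln (real N powr \<theta>)}"
  have \<Omega>: "?\<Omega> = PiE {..<N} (\<lambda>_. {1..X})" by (simp add: sample_space_def X_def)
  have fin\<Omega>: "finite ?\<Omega>" unfolding \<Omega> by (intro finite_PiE) auto
  have card\<Omega>: "card ?\<Omega> = X ^ N" unfolding \<Omega> by (simp add: card_PiE)
  have "?\<Omega> \<noteq> {}" using card\<Omega> X by fastforce
  then have "prob_event \<alpha> \<theta> N = card (?\<Omega> \<inter> ?E) / card ?\<Omega>"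
    unfolding prob_event_def using fin\<Omega> by (rule measure_pmf_of_set)
  also have "?\<Omega> \<inter> ?E \<subseteq> collision_free P X N {}"
  proof
    fix T assume T: "T \<in> ?\<Omega> \<inter> ?E"
    have "\<not> (p dvd T j \<and> p dvd T k)" if jk: "j < N" "k < j" and p: "p \<in> P" for j k p
    proof
      assume d: "p dvd T j \<and> p dvd T k"
      have "T \<in> PiE {..<N} (\<lambda>_. {1..X})" using T unfolding \<Omega> by (rule IntD1)
      from PiE_mem[OF this, of j] have "T j \<in> {1..X}" using jk by simp
      then have "p \<le> Lambda (T j) (T k)" using d P[OF p] by (intro le_Lambda) auto
      also have "\<dots> \<le> Max {Lambda (T j) (T k) | j k. k < j \<and> j < N}"
      proof (rule Max_ge)
        have "{Lambda (T j) (T k) | j k. k < j \<and> j < N} \<subseteq> (\<lambda>(j,k). Lambda (T j) (T k)) ` ({..<N} \<times> {..<N})"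
          by force
        then show "finite {Lambda (T j) (T k) | j k. k < j \<and> j < N}" by (rule finite_subset) auto
      qed (use jk in auto)
      finally have "real p \<le> real (Max {Lambda (T j) (T k) | j k. k < j \<and> j < N})" by simp
      with large[OF p] T show False by auto
    qed
    moreover have "T \<in> PiE {..<N} (\<lambda>_. {1..X})" using T unfolding \<Omega> by (rule IntD1)
    ultimately show "T \<in> collision_free P X N {}" unfolding collision_free_def by blast
  qed
  then have "card (?\<Omega> \<inter> ?E) / card ?\<Omega> \<le> card (collision_free P X N {}) / card ?\<Omega>"
    by (intro divide_right_mono of_nat_mono card_mono) auto
  also have "\<dots> \<le> X ^ N * exp (- c * N * inverse_sum 1 {} - c * inverse_sum 2 P * (real N * (real N - 1) / 2) + N * error_term P y X N) / card ?\<Omega>"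
    by (intro divide_right_mono card_collision_free_le fin P y X c c0) auto
  also have "\<dots> = exp (- c * inverse_sum 2 P * (real N * (real N - 1) / 2) + N * error_term P y X N)"
    using X unfolding card\<Omega> by (simp add: inverse_sum_def)
  finally show ?thesis .
qed

section \<open>Asymptotics\<close>

definition threshold :: "real \<Rightarrow> nat \<Rightarrow> nat" where
  "threshold \<theta> N = nat \<lfloor>real N ^ 2 / (\<theta> * ln N)\<rfloor>"

lemma threshold_bounds:
  assumes "\<theta> > 0" "N \<ge> 2"
  shows "threshold \<theta> N \<le> real N ^ 2 / (\<theta> * ln N)" "real N ^ 2 / (\<theta> * ln N) - 1 < threshold \<theta> N"
proof -
  have "real N ^ 2 / (\<theta> * ln N) \<ge> 0" using assms by simp
  then show "threshold \<theta> N \<le> real N ^ 2 / (\<theta> * ln N)" "real N ^ 2 / (\<theta> * ln N) - 1 < threshold \<theta> N"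
    unfolding threshold_def by linarith+
qed

lemma filterlim_threshold:
  assumes "\<theta> > 0" shows "filterlim (threshold \<theta>) sequentially sequentially"
proof -
  have "filterlim (\<lambda>N. real N ^ 2 / (\<theta> * ln N) - 1) at_top sequentially"
    using assms by real_asymp
  moreover have "eventually (\<lambda>N. real N ^ 2 / (\<theta> * ln N) - 1 \<le> real (threshold \<theta> N)) sequentially"
    using eventually_ge_at_top[of 2] by eventually_elim (use threshold_bounds[OF assms] in \<open>auto intro: less_imp_le\<close>)
  ultimately have "filterlim (\<lambda>N. real (threshold \<theta> N)) at_top sequentially"
    by (rule filterlim_at_top_mono)
  then show ?thesis by (simp add: filterlim_sequentially_iff_filterlim_real)
qed

text \<open>Every prime in the range has \<open>ln p \<le> L\<close>, so dividing by
  \<open>L\<close> removes the logarithmic weights.\<close>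

lemma inverse_sum_2_primes_between_lower:
  assumes "(\<Sum>p\<in>primes_between y (10 * y). ln p / real p ^ 2) \<ge> a" and "L > 0" "ln (10 * real y) \<le> L"
  shows "inverse_sum 2 (primes_between y (10 * y)) \<ge> a / L"
proof -
  have "a / L \<le> (\<Sum>p\<in>primes_between y (10 * y). ln p / real p ^ 2) / L"
    using assms by (intro divide_right_mono) auto
  also have "\<dots> \<le> inverse_sum 2 (primes_between y (10 * y))"
    unfolding inverse_sum_def sum_divide_distrib
  proof (rule sum_mono)
    fix p assume "p \<in> primes_between y (10 * y)"
    then have p: "0 < p" "p \<le> 10 * y" by (auto simp: primes_between_def prime_gt_0_nat)
    then have "real p \<le> real (10 * y)" by (simp only: of_nat_le_iff)
    then have "ln p \<le> ln (10 * real y)" using p by simp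
    then have "ln p / L \<le> 1" using assms by simp
    then have "ln p / L / real p ^ 2 \<le> 1 / real p ^ 2" by (intro divide_right_mono) auto
    then show "ln p / real p ^ 2 / L \<le> 1 / real p ^ 2" by (simp add: mult.commute)
  qed
  finally show ?thesis .
qed

theorem theorem1p1:
  fixes \<alpha> \<theta> :: real
  assumes "\<alpha> > 0" and "\<theta> > 0"
  shows "limsup (\<lambda>N. ereal (prob_event \<alpha> \<theta> N)) \<le> ereal (exp (- \<theta> / 8))"
proof (rule Limsup_bounded)
  define u where "u = (\<lambda>N. real N ^ 2 / (\<theta> * ln N))"
  let ?Y = "threshold \<theta>" and ?X = "\<lambda>N. nat \<lfloor>exp (\<alpha> * real N)\<rfloor>"
  have ev_Y: "eventually (\<lambda>N. Q (?Y N)) sequentially" if "eventually Q sequentially" for Q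
    using that filterlim_threshold[OF \<open>\<theta> > 0\<close>] by (rule eventually_compose_filterlim)
  have "eventually (\<lambda>n::nat. 12 / ln n \<le> 1 / 20) sequentially" by real_asymp
  note ev = ev_Y[OF sum_ln_prime_over_square] ev_Y[OF sum_inverse_prime_le] ev_Y[OF this]
    ev_Y[OF eventually_gt_at_top[of 0]] eventually_ge_at_top[of "40 :: nat"]
  moreover have "eventually (\<lambda>N. 10 * u N \<le> real N ^ 2) sequentially"
    unfolding u_def using assms by real_asymp
  moreover have "eventually (\<lambda>N. u N > 1 \<and> real N * 2 / (u N - 1) \<le> 1 / 40) sequentially"
    unfolding u_def using assms by (intro eventually_conj; real_asymp)
  moreover have "eventually (\<lambda>N. exp (\<alpha> * real N) > 2) sequentially"
    using assms by real_asymp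
  \<comment> \<open>The total error over \<open>N\<close> draws vanishes: its first part is
    exponentially small, and its second is of order (ln N)^2 / N.\<close>
  moreover have "eventually (\<lambda>N. real N * ((2 + real N) * real N ^ 2 / (exp (\<alpha> * real N) - 1) + real N ^ 2 / (u N - 1) ^ 2) \<le> \<theta> / 200) sequentially"
    unfolding u_def using assms by real_asymp
  ultimately show "eventually (\<lambda>N. ereal (prob_event \<alpha> \<theta> N) \<le> ereal (exp (- \<theta> / 8))) sequentially"
  proof eventually_elim
    case (elim N)
    define y where "y = ?Y N"
    define P where "P = primes_between y (10 * y)"
    let ?\<sigma> = "inverse_sum 2 P" and ?R = "inverse_sum 1 P"
    have N: "N \<ge> 40" by fact
    have lnN: "ln N > 0" using N by simp
    have y: "y > 0" "y \<le> u N" "u N - 1 < y"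
      using elim(4) threshold_bounds[of \<theta> N] N \<open>\<theta> > 0\<close> by (auto simp: y_def u_def)
    have u: "u N > 1" and uN: "real N * 2 / (u N - 1) \<le> 1 / 40" using elim(7) by auto
    have P: "prime p \<and> y < p" if "p \<in> P" for p using that by (auto simp: P_def primes_between_def)
    have R: "?R \<le> 1 / 20" using elim(2,3) by (simp add: P_def y_def inverse_sum_def)
    have "?\<sigma> \<le> ?R / y" using inverse_sum_Suc_le[of y P 1] y P by (simp add: numeral_2_eq_2)
    also have "\<dots> \<le> 1 / y" using R by (intro divide_right_mono) auto
    finally have \<sigma>: "?\<sigma> \<le> 1 / y" .
    have \<sigma>0: "?\<sigma> \<ge> 0" by (rule inverse_sum_nonneg)
    have y1: "1 / y \<le> 1 / (u N - 1)" using y u by (intro divide_left_mono) auto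
    have "N * (?\<sigma> + 1 / y) \<le> N * (2 / (u N - 1))" using \<sigma> y1 by (intro mult_left_mono) auto
    \<comment> \<open>Each of the two subtracted terms is at most 1/40.\<close>
    then have c: "19/20 \<le> 1 - ?R / 2 - N * (?\<sigma> + 1 / y)" using R uN by simp
    have X: "exp (\<alpha> * real N) - 1 \<le> ?X N" "?X N > 0" using elim(8) by linarith+
    have exp1: "exp (\<alpha> * real N) - 1 > 0" using elim(8) by linarith
    have large: "real N ^ 2 / ln (real N powr \<theta>) \<le> p" if "p \<in> P" for p
    proof -
      have "real N ^ 2 / ln (real N powr \<theta>) = u N" using N by (simp add: u_def ln_powr)
      \<comment> \<open>Rounding down to \<open>y\<close> is harmless: an integer prime exceeding
        \<open>y\<close> is at least \<open>y + 1\<close>, hence above \<open>u N\<close>.\<close>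
      also have "\<dots> \<le> y + 1" using y by simp
      also have "\<dots> \<le> p" using P[OF that] by simp
      finally show ?thesis .
    qed
    have "prob_event \<alpha> \<theta> N \<le> exp (- (19/20) * ?\<sigma> * (real N * (real N - 1) / 2) + N * error_term P y (?X N) N)"
      by (rule prob_event_le[of P y]) (erule P | erule large | rule y X c | simp add: P_def)+
    also have "\<dots> \<le> exp (- \<theta> / 8)"
    proof -
      have "error_term P y (?X N) N \<le> (2 + real N) * real N ^ 2 / (exp (\<alpha> * real N) - 1) + real N ^ 2 / (u N - 1) ^ 2"
        unfolding error_term_def
      proof (rule add_mono)
        have "P \<subseteq> {y<..10 * y}" by (auto simp: P_def primes_between_def)
        then have "card P \<le> 10 * y" using card_mono[of "{y<..10 * y}" P] by simp
        then have "real (card P) \<le> 10 * y" by linarith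
        also have "\<dots> \<le> real N ^ 2" using y elim(6) by linarith
        finally have "real (card P) \<le> real N ^ 2" .
        then show "(2 + real N) * card P / ?X N \<le> (2 + real N) * real N ^ 2 / (exp (\<alpha> * real N) - 1)"
          using X exp1 by (intro frac_le mult_left_mono) auto
        have "?\<sigma> ^ 2 \<le> (1 / y) ^ 2" using \<sigma> \<sigma>0 by (intro power_mono)
        moreover have "?\<sigma> / y \<le> (1 / y) ^ 2" using divide_right_mono[OF \<sigma>, of "real y"] by (simp add: power2_eq_square)
        moreover have "(1 / real y) ^ 2 \<le> (1 / (u N - 1)) ^ 2" using y1 by (intro power_mono) auto
        ultimately have "?\<sigma> ^ 2 + ?\<sigma> / y \<le> 2 * (1 / (u N - 1)) ^ 2" by linarith
        then have "real N ^ 2 / 2 * (?\<sigma> ^ 2 + ?\<sigma> / y) \<le> real N ^ 2 / 2 * (2 * (1 / (u N - 1)) ^ 2)"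
          by (intro mult_left_mono) auto
        then show "real N ^ 2 / 2 * (?\<sigma> ^ 2 + ?\<sigma> / y) \<le> real N ^ 2 / (u N - 1) ^ 2"
          by (simp add: power_divide)
      qed
      then have "N * error_term P y (?X N) N \<le> N * ((2 + real N) * real N ^ 2 / (exp (\<alpha> * real N) - 1) + real N ^ 2 / (u N - 1) ^ 2)"
        by (intro mult_left_mono) auto
      also have "\<dots> \<le> \<theta> / 200" by (rule elim(9))
      finally have err: "N * error_term P y (?X N) N \<le> \<theta> / 200" .
      \<comment> \<open>The logarithm of every prime in \<open>P\<close> is thus at most
        \<open>2 * ln N\<close>. Together with \<open>y \<le> u N\<close> this makes
        \<open>?\<sigma>\<close> at least 57/200 times \<theta>/N^2.\<close>
      have "10 * real y \<le> real N ^ 2" using y elim(6) by linarith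
      then have "ln (10 * real y) \<le> ln (real N ^ 2)" using y N by (subst ln_le_cancel_iff) auto
      then have "ln (10 * real y) \<le> 2 * ln N" using N by (simp add: ln_realpow)
      then have "57/100 / y / (2 * ln N) \<le> ?\<sigma>"
        unfolding P_def using elim(1) lnN by (intro inverse_sum_2_primes_between_lower) (auto simp: y_def)
      moreover have "57/200 * \<theta> / N ^ 2 \<le> 57/100 / y / (2 * ln N)"
      proof -
        have "1 / u N \<le> 1 / y" using y u by (intro divide_left_mono) auto
        then have "57/200 / ln N * (1 / u N) \<le> 57/200 / ln N * (1 / y)" using lnN by (intro mult_left_mono) auto
        then show ?thesis using lnN by (simp add: u_def mult_ac)
      qed
      ultimately have "57/200 * \<theta> / N ^ 2 \<le> ?\<sigma>" by linarith
      then have "57/200 * \<theta> / N ^ 2 * (real N * (real N - 1) / 2) \<le> ?\<sigma> * (real N * (real N - 1) / 2)"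
        using N by (intro mult_right_mono) auto
      moreover have "57/200 * \<theta> / N ^ 2 * (real N * (real N - 1) / 2) = 57/400 * \<theta> * (1 - 1 / N)"
        using N by (simp add: field_simps power2_eq_square)
      moreover have "57/400 * \<theta> * (39/40) \<le> 57/400 * \<theta> * (1 - 1 / N)"
        using N \<open>\<theta> > 0\<close> by (intro mult_left_mono) (auto simp: field_simps)
      ultimately have "57/400 * \<theta> * (39/40) \<le> ?\<sigma> * (real N * (real N - 1) / 2)" by linarith
      \<comment> \<open>Numerically, 19/20 * 57/400 * 39/40 - 1/200 is about 0.127, just above
        1/8.\<close>
      then show ?thesis using err \<open>\<theta> > 0\<close> by simp
    qed
    finally show ?case by simp
  qed
qed

end
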